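(* Let $K\subset L$ be a finite field extension. Then $K\subset L$ is simple (i.e., $L=K(\alpha)$ for some $\alpha\in L$) if and only if $\mathrm{d}_K(L)=[L:K]$.
   Context: For an algebraic field extension $K\subset L$ and $\alpha\in L$, $\mathrm{id}_K(\alpha)$ is the minimum integer $n\geq 1$ such that $\alpha$ is a root of a monic polynomial of degree $n$ in $K[T]$, and the integral degree of $L$ over $K$ is $\mathrm{d}_K(L)=\sup\{\mathrm{id}_K(\alpha)\mid \alpha\in L\}$ (possibly $\infty$). *)

theory Defs
  imports "HOL-Algebra.Algebra" "HOL-Library.Extended_Nat"
begin

text \<open>
  As in \<^theory>\<open>HOL-Algebra.Finite_Extensions\<close>, the ambient structure is the big field and the
  base field is a subset of its carrier. Polynomials are coefficient lists with the leading
  coefficient first. The zero polynomial is the empty list, so \<open>degree p = n\<close> with \<open>n \<ge> 1\<close>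
  excludes it. If the element is not algebraic over \<open>K\<close>, then \<open>elem_integral_degree\<close> is
  unspecified; both definitions are meant for algebraic extensions.
\<close>

definition (in ring) elem_integral_degree :: "'a set \<Rightarrow> 'a \<Rightarrow> nat"
  where "elem_integral_degree K \<alpha> =
    (LEAST n. n \<ge> 1 \<and>
      (\<exists>p \<in> carrier (K[X]). lead_coeff p = \<one> \<and> degree p = n \<and> eval p \<alpha> = \<zero>))"

definition (in ring) integral_degree :: "'a set \<Rightarrow> enat"
  where "integral_degree K = (SUP \<alpha>\<in>carrier R. enat (elem_integral_degree K \<alpha>))"

end

theory Submission
  imports Defs
begin

text \<open>
  For finite \<open>L/K\<close>, the integral degree of \<open>\<alpha>\<close> is the degree of its minimal polynomial, which
  equals \<open>[K(\<alpha>):K]\<close>. By comparing dimensions it is at most \<open>[L:K]\<close>, with equality exactly when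
  \<open>K(\<alpha>) = L\<close>; and a bounded supremum of natural numbers is attained.
\<close>

text \<open>Bridges the field K(x) of the theorem and the ring K[x] that powers of x span.
  Algebraicity makes K[x] a field, so it contains K(x); conversely K(x) is a subring containing K
  and x.\<close>

lemma (in field) generate_field_eq_simple_extension:
  assumes "subfield K R" and "x \<in> carrier R" and "(algebraic over K) x"
  shows "generate_field R (K \<union> {x}) = simple_extension K x"
proof
  have K: "subring K R" and incl: "K \<union> {x} \<subseteq> carrier R"
    using subfieldE(1,3)[OF assms(1)] assms(2) by auto
  have "subfield (simple_extension K x) R"
    using simple_extension_is_subfield[OF assms(1,2)] assms(3) by simp
  moreover have "K \<union> {x} \<subseteq> simple_extension K x"
    using simple_extension_incl[OF subringE(1)[OF K] assms(2)] simple_extension_mem[OF K assms(2)]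
    by simp
  ultimately show "generate_field R (K \<union> {x}) \<subseteq> simple_extension K x"
    by (rule generate_field_min_subfield1[OF incl])
  show "simple_extension K x \<subseteq> generate_field R (K \<union> {x})"
  proof (rule simple_extension_subring_incl)
    show "subring (generate_field R (K \<union> {x})) R"
      by (rule subfieldE(1)[OF generate_field_is_subfield[OF incl]])
  qed (auto intro: generate_field.incl)
qed

text \<open>The minimal polynomial is a monic witness of positive degree, being irreducible. It
  divides every polynomial over K vanishing at x, so no nonzero one has smaller degree.\<close>

lemma (in domain) elem_integral_degree_eq_degree_Irr:
  assumes "subfield K R" and "x \<in> carrier R" and "(algebraic over K) x"
  shows "elem_integral_degree K x = degree (Irr K x)"
  unfolding elem_integral_degree_def
proof (rule Least_equality, intro conjI)
  note Irr = IrrE[OF assms]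
  show "1 \<le> degree (Irr K x)"
    using pirreducible_degree[OF assms(1) Irr(1,2)] .
  show "\<exists>p\<in>carrier (K[X]). lead_coeff p = \<one> \<and> degree p = degree (Irr K x) \<and> eval p x = \<zero>"
    using Irr by blast
next
  fix n
  assume "1 \<le> n \<and> (\<exists>p\<in>carrier (K[X]). lead_coeff p = \<one> \<and> degree p = n \<and> eval p x = \<zero>)"
  then obtain p where p: "p \<in> carrier (K[X])" "degree p = n" "eval p x = \<zero>" "p \<noteq> []"
    by fastforce
  show "degree (Irr K x) \<le> n"
    using pdivides_imp_degree_le[OF subfieldE(1)[OF assms(1)] IrrE(1)[OF assms] p(1,4)
        Irr_minimal[OF assms p(1,3)]] p(2)
    by simp
qed

text \<open>With d the degree of the minimal polynomial, the powers of x with exponents below d are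
  independent over K and span K(x). Hence d \<le> n, and d = n exactly when they span the whole
  field.\<close>

lemma (in field) degree_Irr_dimension:
  assumes "subfield K R" and "dimension n K (carrier R)" and "x \<in> carrier R"
    and "(algebraic over K) x"
  shows "degree (Irr K x) \<le> n"
    and "degree (Irr K x) = n \<longleftrightarrow> carrier R = generate_field R (K \<union> {x})"
proof -
  let ?B = "exp_base x (degree (Irr K x))"
  have len: "length ?B = degree (Irr K x)"
    by (simp add: exp_base_def)
  note B = exp_base_independent[OF assms(1,3,4)] exp_base_closed[OF assms(3)]
  show "degree (Irr K x) \<le> n"
    using independent_length_le_dimension[OF assms(1,2) B] len by simp
  show "degree (Irr K x) = n \<longleftrightarrow> carrier R = generate_field R (K \<union> {x})"
    using independent_length_eq_dimension[OF assms(1,2) B] len Span_exp_base[OF assms(1,3,4)]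
      generate_field_eq_simple_extension[OF assms(1,3,4)]
    by auto
qed

lemma SUP_enat_eq_bound_iff:
  fixes f :: "'a \<Rightarrow> nat"
  assumes "A \<noteq> {}" and "\<And>x. x \<in> A \<Longrightarrow> f x \<le> n"
  shows "(SUP x\<in>A. enat (f x)) = enat n \<longleftrightarrow> (\<exists>x\<in>A. f x = n)"
proof
  \<comment> \<open>The bound leaves finitely many values. For a finite nonempty set
    \<open>Sup_enat_def\<close> gives \<open>Max\<close>, which is a member; the empty set would
    have supremum 0, attained nowhere.\<close>
  have fin: "finite ((\<lambda>x. enat (f x)) ` A)"
    by (rule finite_subset[of _ "enat ` {..n}"]) (use assms(2) in auto)
  assume "(SUP x\<in>A. enat (f x)) = enat n"
  then have "Max ((\<lambda>x. enat (f x)) ` A) = enat n"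
    using fin assms(1) by (simp add: Sup_enat_def)
  then show "\<exists>x\<in>A. f x = n"
    using Max_in[OF fin] assms(1) by auto
next
  assume "\<exists>x\<in>A. f x = n"
  then show "(SUP x\<in>A. enat (f x)) = enat n"
    using assms(2) by (intro antisym SUP_least) (auto intro: SUP_upper2)
qed

theorem proposition4p2:
  fixes L :: "('a, 'b) ring_scheme" and K :: "'a set"
  assumes "field L"
    and "subfield K L"
    and "ring.finite_dimension L K (carrier L)"
  shows "(\<exists>\<alpha>\<in>carrier L. carrier L = generate_field L (K \<union> {\<alpha>})) \<longleftrightarrow>
    ring.integral_degree L K = enat (ring.dim L K (carrier L))"
proof -
  interpret field L by (rule assms(1))
  have dim: "dimension (dim K (carrier L)) K (carrier L)"
    using finite_dimensionE[OF assms(2,3)] by (simp add: over_def)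
  have alg: "(algebraic over K) x" if "x \<in> carrier L" for x
    using finite_dimension_imp_algebraic[OF assms(2) carrier_is_subring assms(3) that] .
  note deg = elem_integral_degree_eq_degree_Irr[OF assms(2) _ alg]
    and bound = degree_Irr_dimension[OF assms(2) dim _ alg]
  \<comment> \<open>The equality of degrees becomes the existence of an element of full degree; by
    \<open>bound(2)\<close> such elements are exactly the primitive ones.\<close>
  have "integral_degree K = enat (dim K (carrier L)) \<longleftrightarrow>
      (\<exists>x\<in>carrier L. elem_integral_degree K x = dim K (carrier L))"
    unfolding integral_degree_def
    by (rule SUP_enat_eq_bound_iff) (use deg bound(1) in auto)
  then show ?thesis
    using deg bound(2) by auto
qed

end
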